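(* Let $g$ be a Schwartz class function on $\mathbb{C}$. If any one of the functions $$Zg,\quad \partial_zg,\quad \partial_{\bar z}\bar g,\quad \bar Z\bar g,\quad L^{1/2}g$$ is in $W(C_0,\ell^2)$, then $\mathcal{G}^t(g,1,1)=\{T^t_{(m,n)}g:m,n\in\mathbb{Z}\}$ cannot be a twisted Gabor frame for $L^2(\mathbb{C})$.
   Context: Write $z=x+iy\in\mathbb{C}$ and identify $\mathbb{C}$ with $\mathbb{R}^2$ (Lebesgue measure). For $m,n\in\mathbb{Z}$ and $f\in L^2(\mathbb{C})$, the twisted translation is $$T^t_{(m,n)}f(z)=e^{2\pi i(my-nx)}f(x-m,y-n).$$ $\mathcal{G}^t(g,1,1)$ is a twisted Gabor frame for $L^2(\mathbb{C})$ if there are constants $A,B>0$ with $A\|f\|_2^2\le\sum_{m,n\in\mathbb{Z}}|\langle f,T^t_{(m,n)}g\rangle|^2\le B\|f\|_2^2$ for all $f\in L^2(\mathbb{C})$. Amalgam space: $W(L^\infty,\ell^2)$ is the space of measurable $f:\mathbb{R}^2\to\mathbb{C}$ with $\big(\sum_{k\in\mathbb{Z}^2}\|f\cdot\chi_{k+[0,1)^2}\|_\infty^2\big)^{1/2}<\infty$, and $W(C_0,\ell^2)=\{f\in W(L^\infty,\ell^2): f\text{ continuous}\}$. Operators: $\partial_z=\frac{d}{dz}=\frac{\partial}{\partial x}-i\frac{\partial}{\partial y}$, $\partial_{\bar z}=\frac{d}{d\bar z}=\frac{\partial}{\partial x}+i\frac{\partial}{\partial y}$, $Z=\partial_z+2\pi\bar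 z$, $\bar Z=\partial_{\bar z}-2\pi z$, and $\bar g$ is the complex conjugate of $g$. The special Hermite operator is $L=-\frac12(Z\bar Z+\bar ZZ)$; it is positive self-adjoint on $L^2(\mathbb{C})$ with spectrum $\{4\pi(2n+1):n=0,1,2,\dots\}$, and $L^{1/2}$ is its positive square root. *)

theory Defs
  imports "HOL-Analysis.Analysis" "HOL-Probability.Essential_Supremum"
begin

text \<open>Elements are honest functions; equality almost everywhere is never quotiented out.\<close>

definition L2 :: "(complex \<Rightarrow> complex) set" where
  "L2 = {f. f \<in> borel_measurable lebesgue \<and> integrable lebesgue (\<lambda>z. (cmod (f z))\<^sup>2)}"

definition L2_inner :: "(complex \<Rightarrow> complex) \<Rightarrow> (complex \<Rightarrow> complex) \<Rightarrow> complex" where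
  "L2_inner f h = (LINT z|lebesgue. f z * cnj (h z))"

definition L2_norm :: "(complex \<Rightarrow> complex) \<Rightarrow> real" where
  "L2_norm f = sqrt (LINT z|lebesgue. (cmod (f z))\<^sup>2)"

definition twisted_translation ::
    "int \<Rightarrow> int \<Rightarrow> (complex \<Rightarrow> complex) \<Rightarrow> complex \<Rightarrow> complex" where
  "twisted_translation m n f z =
     exp (2 * of_real pi * \<i> * of_real (of_int m * Im z - of_int n * Re z))
       * f (z - Complex (of_int m) (of_int n))"

text \<open>The series is taken in the extended nonnegative reals, so that the upper bound includes
  its convergence.\<close>

definition twisted_gabor_frame :: "(complex \<Rightarrow> complex) \<Rightarrow> bool" where
  "twisted_gabor_frame g \<longleftrightarrow>
     (\<exists>A B :: real. A > 0 \<and> B > 0 \<and>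
       (\<forall>f\<in>L2.
          ennreal (A * (L2_norm f)\<^sup>2)
            \<le> infsum (\<lambda>(m, n). ennreal ((cmod (L2_inner f (twisted_translation m n g)))\<^sup>2)) UNIV \<and>
          infsum (\<lambda>(m, n). ennreal ((cmod (L2_inner f (twisted_translation m n g)))\<^sup>2)) UNIV
            \<le> ennreal (B * (L2_norm f)\<^sup>2)))"

definition unit_square :: "int \<Rightarrow> int \<Rightarrow> complex set" where
  "unit_square j k =
     {z. of_int j \<le> Re z \<and> Re z < of_int j + 1 \<and> of_int k \<le> Im z \<and> Im z < of_int k + 1}"

definition Linf_norm :: "(complex \<Rightarrow> complex) \<Rightarrow> ennreal" where
  "Linf_norm f = esssup lebesgue (\<lambda>z. ennreal (cmod (f z)))"

definition amalgam_Linf_l2 :: "(complex \<Rightarrow> complex) set" where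
  "amalgam_Linf_l2 =
     {f. f \<in> borel_measurable lebesgue \<and>
         infsum (\<lambda>(j, k). (Linf_norm (\<lambda>z. f z * indicator (unit_square j k) z))\<^sup>2) UNIV < \<infinity>}"

definition amalgam_C0_l2 :: "(complex \<Rightarrow> complex) set" where
  "amalgam_C0_l2 = {f \<in> amalgam_Linf_l2. continuous_on UNIV f}"

definition partial_x :: "(complex \<Rightarrow> complex) \<Rightarrow> complex \<Rightarrow> complex" where
  "partial_x f z = vector_derivative (\<lambda>t :: real. f (z + of_real t)) (at 0)"

definition partial_y :: "(complex \<Rightarrow> complex) \<Rightarrow> complex \<Rightarrow> complex" where
  "partial_y f z = vector_derivative (\<lambda>t :: real. f (z + \<i> * of_real t)) (at 0)"

text \<open>Differentiability is over the reals: \<^term>\<open>f differentiable at z\<close> is existence of the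
  Frechet derivative on the real vector space underlying the complex plane.\<close>

primrec Ck :: "nat \<Rightarrow> (complex \<Rightarrow> complex) \<Rightarrow> bool" where
  "Ck 0 f \<longleftrightarrow> continuous_on UNIV f"
| "Ck (Suc k) f \<longleftrightarrow> (\<forall>z. f differentiable at z) \<and> Ck k (partial_x f) \<and> Ck k (partial_y f)"

definition schwartz :: "(complex \<Rightarrow> complex) \<Rightarrow> bool" where
  "schwartz f \<longleftrightarrow>
     (\<forall>k. Ck k f) \<and>
     (\<forall>a b p q :: nat.
        bounded (range (\<lambda>z. of_real (Re z ^ a * Im z ^ b) * ((partial_x ^^ p) ((partial_y ^^ q) f)) z)))"

text \<open>The Wirtinger operators are used without the customary factor \<open>1/2\<close>.\<close>

definition d_z :: "(complex \<Rightarrow> complex) \<Rightarrow> complex \<Rightarrow> complex" where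
  "d_z f z = partial_x f z - \<i> * partial_y f z"

definition d_zbar :: "(complex \<Rightarrow> complex) \<Rightarrow> complex \<Rightarrow> complex" where
  "d_zbar f z = partial_x f z + \<i> * partial_y f z"

definition Z_op :: "(complex \<Rightarrow> complex) \<Rightarrow> complex \<Rightarrow> complex" where
  "Z_op f z = d_z f z + 2 * of_real pi * cnj z * f z"

definition Zbar_op :: "(complex \<Rightarrow> complex) \<Rightarrow> complex \<Rightarrow> complex" where
  "Zbar_op f z = d_zbar f z - 2 * of_real pi * z * f z"

text \<open>An unbounded operator on \<open>L\<^sup>2(\<complex>)\<close> is represented by its graph, a relation between functions
  (modulo equality almost everywhere, under which closures and adjoints below are invariant).\<close>

type_synonym L2_operator = "((complex \<Rightarrow> complex) \<times> (complex \<Rightarrow> complex)) set"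

definition op_closure :: "L2_operator \<Rightarrow> L2_operator" where
  "op_closure R =
     {(f, h). f \<in> L2 \<and> h \<in> L2 \<and>
        (\<exists>F H. (\<forall>n :: nat. (F n, H n) \<in> R) \<and>
           (\<lambda>n. L2_norm (\<lambda>z. F n z - f z)) \<longlonglongrightarrow> 0 \<and>
           (\<lambda>n. L2_norm (\<lambda>z. H n z - h z)) \<longlonglongrightarrow> 0)}"

definition op_adjoint :: "L2_operator \<Rightarrow> L2_operator" where
  "op_adjoint R =
     {(u, v). u \<in> L2 \<and> v \<in> L2 \<and> (\<forall>(f, h)\<in>R. L2_inner h u = L2_inner f v)}"

definition densely_defined :: "L2_operator \<Rightarrow> bool" where
  "densely_defined R \<longleftrightarrow> (\<forall>f\<in>L2. \<forall>e>0. \<exists>u\<in>Domain R. L2_norm (\<lambda>z. f z - u z) < e)"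

text \<open>For a densely defined relation, being equal to its own adjoint already entails linearity and
  single-valuedness up to equality almost everywhere.\<close>

definition self_adjoint :: "L2_operator \<Rightarrow> bool" where
  "self_adjoint R \<longleftrightarrow> densely_defined R \<and> op_adjoint R = R"

definition positive_op :: "L2_operator \<Rightarrow> bool" where
  "positive_op R \<longleftrightarrow> (\<forall>(f, h)\<in>R. L2_inner h f \<in> \<real>\<^sub>\<ge>\<^sub>0)"

definition is_positive_sqrt :: "L2_operator \<Rightarrow> L2_operator \<Rightarrow> bool" where
  "is_positive_sqrt S R \<longleftrightarrow> self_adjoint S \<and> positive_op S \<and> S O S = R"

text \<open>A positive self-adjoint operator has exactly one positive self-adjoint square root.\<close>

definition op_sqrt :: "L2_operator \<Rightarrow> L2_operator" where
  "op_sqrt R = (THE S. is_positive_sqrt S R)"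

text \<open>The differential expression is essentially self-adjoint on the Schwartz class (which contains
  an orthonormal basis of eigenfunctions, the special Hermite functions); the self-adjoint
  operator it determines is the closure.\<close>

definition special_hermite_expr :: "(complex \<Rightarrow> complex) \<Rightarrow> complex \<Rightarrow> complex" where
  "special_hermite_expr f z = - (1 / 2) * (Z_op (Zbar_op f) z + Zbar_op (Z_op f) z)"

definition special_hermite :: L2_operator where
  "special_hermite = op_closure {(f, special_hermite_expr f) | f. schwartz f}"

end

theory Submission
  imports Defs
begin

text \<open>The index set \<open>\<int>\<^sup>2\<close> is far too thin for functions of two real variables, whose phase space is
  four-dimensional, and this breaks the lower frame bound \<open>A\<close>. It is enough
  to test it on the indicator function of a small set \<open>E\<close> inside the unit square. Its squared norm
  is the measure \<open>\<bar>E\<bar>\<close>. Each coefficient is at most \<open>\<bar>E\<bar>\<close> times the supremum of \<open>\<bar>g\<bar>\<close> over a unit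
  square of the integer grid, every square being used once, so the squared coefficients add up to at
  most \<open>\<bar>E\<bar>\<^sup>2 S\<close>, where \<open>S\<close> is the sum of the squared suprema
  (\<open>sum_indicator_coefficients_le\<close>). If \<open>S\<close> is finite, the lower bound gives
  \<open>A \<bar>E\<bar> \<le> \<bar>E\<bar>\<^sup>2 S\<close>, that is \<open>A \<le> \<bar>E\<bar> S\<close>, which is false once \<open>\<bar>E\<bar>\<close> is small
  (\<open>not_twisted_gabor_frame_if_grid_bounds\<close>). Rapid decay makes \<open>S\<close> finite for a Schwartz function
  (\<open>schwartz_grid_bound\<close>).\<close>

section \<open>Frame coefficients of small indicator functions\<close>

lemma cmod_twisted_translation:
  "cmod (twisted_translation m n g z) = cmod (g (z - Complex (of_int m) (of_int n)))"
proof -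
  have "2 * of_real pi * \<i> * of_real (of_int m * Im z - of_int n * Re z)
      = \<i> * of_real (2 * pi * (of_int m * Im z - of_int n * Re z))"
    by simp
  then show ?thesis
    unfolding twisted_translation_def norm_mult by (simp only: norm_exp_i_times mult_1)
qed

lemma diff_mem_unit_square:
  assumes "z \<in> unit_square 0 0"
  shows "z - Complex (of_int m) (of_int n) \<in> unit_square (- m) (- n)"
  using assms by (simp add: unit_square_def)

lemma indicator_in_L2:
  assumes "E \<in> lmeasurable"
  shows "indicator E \<in> L2" and "(L2_norm (indicator E))\<^sup>2 = measure lebesgue E"
proof -
  have sq: "(\<lambda>z. (cmod (indicator E z))\<^sup>2) = indicat_real E"
    by (auto simp: indicator_def fun_eq_iff)
  have "integrable lebesgue (indicat_real E)"
    using assms by (intro integrable_real_indicator) (auto simp: fmeasurable_def)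
  moreover have "indicator E \<in> borel_measurable lebesgue"
    using assms by (intro borel_measurable_indicator) (simp add: fmeasurableD)
  ultimately show "indicator E \<in> L2"
    by (simp add: L2_def sq)
  show "(L2_norm (indicator E))\<^sup>2 = measure lebesgue E"
    by (simp add: L2_norm_def sq)
qed

lemma indicator_coefficient_le:
  assumes E: "E \<in> lmeasurable" "E \<subseteq> unit_square 0 0"
    and bound: "\<And>j k z. z \<in> unit_square j k \<Longrightarrow> cmod (g z) \<le> M j k"
  shows "cmod (L2_inner (indicator E) (twisted_translation m n g))
           \<le> measure lebesgue E * M (- m) (- n)"
proof -
  have M_nonneg: "0 \<le> M (- m) (- n)"
  proof -
    have "Complex (of_int (- m)) (of_int (- n)) \<in> unit_square (- m) (- n)"
      by (simp add: unit_square_def)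
    then show ?thesis
      using bound norm_ge_zero order_trans by blast
  qed
  have "cmod (L2_inner (indicator E) (twisted_translation m n g))
      \<le> (LINT z|lebesgue. cmod (indicator E z * cnj (twisted_translation m n g z)))"
    unfolding L2_inner_def by (rule integral_norm_bound)
  also have "\<dots> \<le> (LINT z|lebesgue. M (- m) (- n) * indicat_real E z)"
  proof (rule integral_mono')
    show "integrable lebesgue (\<lambda>z. M (- m) (- n) * indicat_real E z)"
      using E(1) by (intro integrable_mult_right integrable_real_indicator) (auto simp: fmeasurable_def)
    show "cmod (indicator E z * cnj (twisted_translation m n g z)) \<le> M (- m) (- n) * indicat_real E z"
      for z
      using E(2) bound[OF diff_mem_unit_square, of z m n]
      by (auto simp: indicator_def norm_mult cmod_twisted_translation)
    show "0 \<le> M (- m) (- n) * indicat_real E z" for z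
      using M_nonneg by simp
  qed
  also have "\<dots> = measure lebesgue E * M (- m) (- n)"
    by simp
  finally show ?thesis .
qed

text \<open>The quadratic dependence on the measure of \<open>E\<close> is the point: the squared norm of the indicator
  function, with which the frame inequality compares this sum, is only linear in it.\<close>

lemma sum_indicator_coefficients_le:
  assumes E: "E \<in> lmeasurable" "E \<subseteq> unit_square 0 0"
    and bound: "\<And>j k z. z \<in> unit_square j k \<Longrightarrow> cmod (g z) \<le> M j k"
    and summable: "(\<lambda>(j, k). (M j k)\<^sup>2) summable_on UNIV"
  shows "infsum (\<lambda>(m, n). ennreal ((cmod (L2_inner (indicator E) (twisted_translation m n g)))\<^sup>2)) UNIV
           \<le> ennreal ((measure lebesgue E)\<^sup>2 * infsum (\<lambda>(j, k). (M j k)\<^sup>2) UNIV)"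
proof (rule infsum_le_finite_sums)
  fix F :: "(int \<times> int) set"
  assume F: "finite F"
  let ?c = "\<lambda>(m, n). (cmod (L2_inner (indicator E) (twisted_translation m n g)))\<^sup>2"
  let ?neg = "\<lambda>(m, n). (- m, - n) :: int \<times> int"
  have "sum ?c F \<le> (\<Sum>(m, n)\<in>F. (measure lebesgue E * M (- m) (- n))\<^sup>2)"
    by (intro sum_mono) (auto intro!: power_mono indicator_coefficient_le[OF E bound])
  also have "\<dots> = (measure lebesgue E)\<^sup>2 * (\<Sum>(m, n)\<in>F. (M (- m) (- n))\<^sup>2)"
    by (simp add: sum_distrib_left power_mult_distrib case_prod_unfold)
  also have "(\<Sum>(m, n)\<in>F. (M (- m) (- n))\<^sup>2) = (\<Sum>(j, k)\<in>?neg ` F. (M j k)\<^sup>2)"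
    by (subst sum.reindex) (auto simp: inj_on_def case_prod_unfold)
  also have "\<dots> \<le> infsum (\<lambda>(j, k). (M j k)\<^sup>2) UNIV"
    by (rule finite_sum_le_infsum[OF summable]) (use F in auto)
  finally have "sum ?c F \<le> (measure lebesgue E)\<^sup>2 * infsum (\<lambda>(j, k). (M j k)\<^sup>2) UNIV"
    by (simp add: mult_left_mono)
  then have "ennreal (sum ?c F) \<le> ennreal ((measure lebesgue E)\<^sup>2 * infsum (\<lambda>(j, k). (M j k)\<^sup>2) UNIV)"
    by (rule ennreal_leI)
  moreover have "ennreal (sum ?c F) = (\<Sum>x\<in>F. ennreal (?c x))"
    by (rule sum_ennreal[symmetric]) auto
  ultimately show "(\<Sum>(m, n)\<in>F. ennreal ((cmod (L2_inner (indicator E) (twisted_translation m n g)))\<^sup>2))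
      \<le> ennreal ((measure lebesgue E)\<^sup>2 * infsum (\<lambda>(j, k). (M j k)\<^sup>2) UNIV)"
    by (simp add: case_prod_unfold)
qed (intro nonneg_summable_on_complete zero_le)

lemma measure_small_square:
  assumes "0 \<le> s"
  shows "measure lebesgue (box 0 (Complex s s)) = s\<^sup>2"
proof -
  have "measure lborel (box 0 (Complex s s)) = (\<Prod>b\<in>Basis. Complex s s \<bullet> b)"
    using assms by (subst measure_lborel_box) (auto simp: Basis_complex_def)
  also have "\<dots> = s\<^sup>2"
    by (simp add: Basis_complex_def power2_eq_square)
  finally show ?thesis
    by simp
qed

text \<open>With the least possible bounds \<open>M\<close> this is the summability condition that defines the amalgam
  space \<open>W(L\<^sup>\<infinity>, \<ell>\<^sup>2)\<close>, with suprema in place of essential suprema. Shrinking \<open>E\<close> exploits the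
  mismatch between the linear left and the quadratic right side of the frame inequality.\<close>

proposition not_twisted_gabor_frame_if_grid_bounds:
  assumes bound: "\<And>j k z. z \<in> unit_square j k \<Longrightarrow> cmod (g z) \<le> M j k"
    and summable: "(\<lambda>(j, k). (M j k)\<^sup>2) summable_on UNIV"
  shows "\<not> twisted_gabor_frame g"
proof
  assume "twisted_gabor_frame g"
  then obtain A where A: "A > 0"
    and lower: "\<And>f. f \<in> L2 \<Longrightarrow> ennreal (A * (L2_norm f)\<^sup>2)
      \<le> infsum (\<lambda>(m, n). ennreal ((cmod (L2_inner f (twisted_translation m n g)))\<^sup>2)) UNIV"
    unfolding twisted_gabor_frame_def by blast
  define S where "S = infsum (\<lambda>(j, k). (M j k)\<^sup>2) UNIV"
  have S: "0 \<le> S"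
    unfolding S_def by (rule infsum_nonneg) auto
  (* The side length s makes the area of E small enough for s^2 * S < A. *)
  define s where "s = sqrt (min 1 (A / (S + 1)))"
  have s_sq: "s\<^sup>2 = min 1 (A / (S + 1))"
    unfolding s_def using A S by (intro real_sqrt_pow2) simp
  have s: "0 < s" "s \<le> 1"
    unfolding s_def using A S by simp_all
  define E where "E = box 0 (Complex s s)"
  have E: "E \<in> lmeasurable" "E \<subseteq> unit_square 0 0"
    unfolding E_def using s by (auto simp: unit_square_def mem_box Basis_complex_def)
  have mu: "measure lebesgue E = s\<^sup>2"
    unfolding E_def using s by (intro measure_small_square) simp
  have "ennreal (A * s\<^sup>2) \<le> ennreal ((s\<^sup>2)\<^sup>2 * S)"
    using order_trans[OF lower[OF indicator_in_L2(1)[OF E(1)]]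
        sum_indicator_coefficients_le[OF E bound summable]]
    by (simp add: indicator_in_L2(2)[OF E(1)] mu S_def)
  then have "A * s\<^sup>2 \<le> (s\<^sup>2)\<^sup>2 * S"
    using S by simp
  then have "A \<le> s\<^sup>2 * S"
    using s by (simp add: power2_eq_square mult.assoc mult.left_commute)
  also have "\<dots> \<le> A / (S + 1) * S"
    unfolding s_sq using S by (intro mult_right_mono) auto
  also have "\<dots> < A"
    using A S by (simp add: divide_simps)
  finally show False
    by simp
qed

section \<open>Square-summable grid bounds for Schwartz functions\<close>

lemma summable_on_int_quadratic:
  "(\<lambda>j :: int. 1 / (1 + (of_int j)\<^sup>2) :: real) summable_on UNIV"
proof -
  let ?q = "\<lambda>j :: int. 1 / (1 + (of_int j)\<^sup>2) :: real"
  have majorant: "summable (\<lambda>n. 2 * inverse (real (Suc n) ^ 2))"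
    using inverse_power_summable[of 2, where ?'a = real]
    by (intro summable_mult) (simp only: summable_Suc_iff[of "\<lambda>n. inverse (real n ^ 2)"] order_refl)
  have le_majorant: "norm (1 / (1 + (real n)\<^sup>2)) \<le> 2 * inverse (real (Suc n) ^ 2)" for n
  proof -
    have "0 \<le> (real n - 1)\<^sup>2"
      by simp
    then have "(real (Suc n))\<^sup>2 \<le> 2 * (1 + (real n)\<^sup>2)"
      by (simp add: power2_eq_square algebra_simps)
    then have "(real (Suc n))\<^sup>2 / (1 + (real n)\<^sup>2) \<le> 2"
      by (subst pos_divide_le_eq) (auto intro: add_pos_nonneg)
    then have "1 / (1 + (real n)\<^sup>2) \<le> 2 / (real (Suc n))\<^sup>2"
      by (subst pos_le_divide_eq) simp_all
    then show ?thesis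
      by (simp add: divide_inverse)
  qed
  have "summable (\<lambda>n. 1 / (1 + (real n)\<^sup>2))"
    by (rule summable_comparison_test'[OF majorant le_majorant])
  then have nat: "(\<lambda>n. 1 / (1 + (real n)\<^sup>2)) summable_on UNIV"
    by (subst summable_on_UNIV_nonneg_real_iff) simp_all
  have "?q summable_on range int"
    by (subst summable_on_reindex) (use nat in \<open>auto simp: o_def\<close>)
  moreover have "?q summable_on range (\<lambda>n. - int n)"
    by (subst summable_on_reindex) (use nat in \<open>auto simp: o_def inj_on_def\<close>)
  ultimately have "?q summable_on (range int \<union> range (\<lambda>n. - int n))"
    by (rule summable_on_union)
  moreover have "range int \<union> range (\<lambda>n. - int n) = UNIV"
  proof -
    have "j \<in> range int \<union> range (\<lambda>n. - int n)" for j
      by (cases j rule: int_cases2) auto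
    then show ?thesis
      by blast
  qed
  ultimately show ?thesis
    by simp
qed

lemma summable_on_grid_quadratic:
  "(\<lambda>(j, k). (C / ((1 + (of_int j)\<^sup>2) * (1 + (of_int k)\<^sup>2)))\<^sup>2 :: real) summable_on (UNIV :: (int \<times> int) set)"
proof -
  let ?q = "\<lambda>j :: int. 1 / (1 + (of_int j)\<^sup>2) :: real"
  have q: "0 \<le> ?q j" "?q j \<le> 1" for j
    by (simp_all add: divide_simps add_pos_nonneg)
  have "(\<lambda>(j, k). ?q j * ?q k) summable_on (UNIV \<times> UNIV)"
  proof (rule summable_on_SigmaI)
    show "((\<lambda>k. case (j, k) of (j, k) \<Rightarrow> ?q j * ?q k) has_sum ?q j * infsum ?q UNIV) UNIV" for j
      unfolding prod.case
      by (intro has_sum_cmult_right has_sum_infsum summable_on_int_quadratic)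
    show "(\<lambda>j. ?q j * infsum ?q UNIV) summable_on UNIV"
      by (intro summable_on_cmult_left summable_on_int_quadratic)
  qed (use q in auto)
  then have "(\<lambda>x. C\<^sup>2 * (case x of (j, k) \<Rightarrow> ?q j * ?q k)) summable_on UNIV"
    by (intro summable_on_cmult_right) simp
  then show ?thesis
  proof (rule summable_on_comparison_test)
    fix x :: "int \<times> int"
    obtain j k where x: "x = (j, k)"
      by force
    have "(?q j * ?q k)\<^sup>2 \<le> ?q j * ?q k"
      unfolding power2_eq_square[of "?q j * ?q k"]
      using mult_le_one[OF q(2) q(1) q(2)] mult_nonneg_nonneg[OF q(1) q(1)]
      by (intro mult_left_le)
    then have "C\<^sup>2 * (?q j * ?q k)\<^sup>2 \<le> C\<^sup>2 * (?q j * ?q k)"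
      by (intro mult_left_mono) auto
    then show "(case x of (j, k) \<Rightarrow> (C / ((1 + (of_int j)\<^sup>2) * (1 + (of_int k)\<^sup>2)))\<^sup>2)
        \<le> C\<^sup>2 * (case x of (j, k) \<Rightarrow> ?q j * ?q k)"
      by (simp add: x power_divide power_mult_distrib)
  qed auto
qed

lemma schwartz_quadratic_decay:
  assumes "schwartz g"
  obtains C where "\<And>z. (1 + (Re z)\<^sup>2) * (1 + (Im z)\<^sup>2) * cmod (g z) \<le> C"
proof -
  have bound: "\<exists>c. \<forall>z. \<bar>Re z ^ a * Im z ^ b\<bar> * cmod (g z) \<le> c" for a b
  proof -
    have "bounded (range (\<lambda>z. of_real (Re z ^ a * Im z ^ b)
        * ((partial_x ^^ 0) ((partial_y ^^ 0) g)) z))"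
      by (rule conjunct2[OF assms[unfolded schwartz_def], rule_format])
    then obtain c where
      c: "\<And>z. cmod (of_real (Re z ^ a * Im z ^ b) * ((partial_x ^^ 0) ((partial_y ^^ 0) g)) z) \<le> c"
      unfolding bounded_iff by (auto simp only: ball_simps)
    have "cmod (of_real (Re z ^ a * Im z ^ b) * g z) \<le> c" for z
      using c[of z] by (simp only: funpow_0)
    then show ?thesis
      unfolding norm_mult norm_of_real by blast
  qed
  obtain c\<^sub>1 where c\<^sub>1: "\<forall>z. \<bar>Re z ^ 0 * Im z ^ 0\<bar> * cmod (g z) \<le> c\<^sub>1"
    using bound[where a = 0 and b = 0] by (rule exE)
  obtain c\<^sub>2 where c\<^sub>2: "\<forall>z. \<bar>Re z ^ 2 * Im z ^ 0\<bar> * cmod (g z) \<le> c\<^sub>2"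
    using bound[where a = 2 and b = 0] by (rule exE)
  obtain c\<^sub>3 where c\<^sub>3: "\<forall>z. \<bar>Re z ^ 0 * Im z ^ 2\<bar> * cmod (g z) \<le> c\<^sub>3"
    using bound[where a = 0 and b = 2] by (rule exE)
  obtain c\<^sub>4 where c\<^sub>4: "\<forall>z. \<bar>Re z ^ 2 * Im z ^ 2\<bar> * cmod (g z) \<le> c\<^sub>4"
    using bound[where a = 2 and b = 2] by (rule exE)
  have "(1 + (Re z)\<^sup>2) * (1 + (Im z)\<^sup>2) * cmod (g z) \<le> c\<^sub>1 + c\<^sub>2 + c\<^sub>3 + c\<^sub>4" for z
  proof -
    have "(1 + (Re z)\<^sup>2) * (1 + (Im z)\<^sup>2) * cmod (g z)
        = cmod (g z) + (Re z)\<^sup>2 * cmod (g z) + (Im z)\<^sup>2 * cmod (g z)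
          + (Re z)\<^sup>2 * (Im z)\<^sup>2 * cmod (g z)"
      by (simp add: algebra_simps)
    also have "\<dots> \<le> c\<^sub>1 + c\<^sub>2 + c\<^sub>3 + c\<^sub>4"
      using c\<^sub>1[rule_format, of z] c\<^sub>2[rule_format, of z] c\<^sub>3[rule_format, of z] c\<^sub>4[rule_format, of z]
      by (intro add_mono) (simp_all add: abs_mult)
    finally show ?thesis .
  qed
  then show ?thesis
    by (rule that)
qed

lemma schwartz_grid_bound:
  assumes "schwartz g"
  obtains C where "\<And>j k z. z \<in> unit_square j k
    \<Longrightarrow> cmod (g z) \<le> C / ((1 + (of_int j)\<^sup>2) * (1 + (of_int k)\<^sup>2))"
proof -
  obtain C where C: "\<And>z. (1 + (Re z)\<^sup>2) * (1 + (Im z)\<^sup>2) * cmod (g z) \<le> C"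
    using schwartz_quadratic_decay[OF assms] by blast
  (* The distance from x to j is at most 1, so j^2 <= 2 x^2 + 2. *)
  have near: "1 + (of_int j)\<^sup>2 \<le> 3 * (1 + x\<^sup>2)" if "of_int j \<le> x" "x < of_int j + 1"
    for j :: int and x :: real
  proof -
    have "(x - of_int j)\<^sup>2 \<le> 1"
      using that by (simp add: power_le_one)
    moreover have "0 \<le> (2 * x - of_int j)\<^sup>2"
      by simp
    ultimately have "(of_int j)\<^sup>2 \<le> 2 + 2 * x\<^sup>2"
      by (simp add: power2_eq_square algebra_simps)
    also have "\<dots> \<le> 2 + 3 * x\<^sup>2"
      by simp
    finally show ?thesis
      by simp
  qed
  have "cmod (g z) \<le> 9 * C / ((1 + (of_int j)\<^sup>2) * (1 + (of_int k)\<^sup>2))"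
    if z: "z \<in> unit_square j k" for j k z
  proof -
    have "(1 + (of_int j)\<^sup>2) * (1 + (of_int k)\<^sup>2) \<le> (3 * (1 + (Re z)\<^sup>2)) * (3 * (1 + (Im z)\<^sup>2))"
      using z by (intro mult_mono near) (auto simp: unit_square_def)
    then have "(1 + (of_int j)\<^sup>2) * (1 + (of_int k)\<^sup>2) * cmod (g z)
        \<le> (3 * (1 + (Re z)\<^sup>2)) * (3 * (1 + (Im z)\<^sup>2)) * cmod (g z)"
      by (rule mult_right_mono) simp
    also have "\<dots> = 9 * ((1 + (Re z)\<^sup>2) * (1 + (Im z)\<^sup>2) * cmod (g z))"
      by (simp add: algebra_simps)
    also have "\<dots> \<le> 9 * C"
      using C[of z] by simp
    finally show ?thesis
      by (subst pos_le_divide_eq) (auto simp: mult.commute intro!: mult_pos_pos add_pos_nonneg)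
  qed
  then show ?thesis
    by (rule that)
qed

theorem theorem1p8:
  fixes g :: "complex \<Rightarrow> complex"
  assumes "schwartz g"
    and "Z_op g \<in> amalgam_C0_l2 \<or>
         d_z g \<in> amalgam_C0_l2 \<or>
         d_zbar (\<lambda>z. cnj (g z)) \<in> amalgam_C0_l2 \<or>
         Zbar_op (\<lambda>z. cnj (g z)) \<in> amalgam_C0_l2 \<or>
         (\<exists>h \<in> amalgam_C0_l2. (g, h) \<in> op_sqrt special_hermite)"
  shows "\<not> twisted_gabor_frame g"
proof -
  obtain C where "\<And>j k z. z \<in> unit_square j k
    \<Longrightarrow> cmod (g z) \<le> C / ((1 + (of_int j)\<^sup>2) * (1 + (of_int k)\<^sup>2))"
    using schwartz_grid_bound[OF assms(1)] by blast
  then show ?thesis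
    using summable_on_grid_quadratic by (rule not_twisted_gabor_frame_if_grid_bounds)
qed

end
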